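(* Let $0^{s_1}1^{t_1}\cdots 0^{s_k}1^{t_k}$ be the binary string of a connected threshold graph $\Gamma$ on $n$ vertices. Then $$2\left[\frac{k(n-t_k)}{n-1}+\sum_{i=1}^k\frac{t_i-1}{t+S_i-1}\right]\ \geq\ E_{\mathcal{A}}(\Gamma)\ \geq\ 2\left[\frac{k}{t}+\sum_{i=1}^k\frac{t_i-1}{t+S_i-1}\right].$$
   Context: Binary strings: a threshold graph with binary string $b=b_1\ldots b_n$ (where $b_1=0$) is the simple graph on vertices $1,\dots,n$ built by adding vertices in order, vertex $i\ge 2$ being added as an isolated vertex if $b_i=0$ and as a dominating vertex (adjacent to all earlier vertices) if $b_i=1$. A connected threshold graph on $n\ge 2$ vertices has $b_n=1$, and its string is written $0^{s_1}1^{t_1}\cdots0^{s_k}1^{t_k}$ with $k\ge1$ and all $s_i,t_i$ positive integers. Put $t=\sum_i t_i$ and $S_i=\sum_{j\le i}s_j$. The normalized adjacency matrix of $\Gamma$ is $\mathcal{A}=D^{-1}A$, where $A$ is the adjacency matrix and $D$ the diagonal matrix of vertex degrees. The normalized adjacency energy is $E_{\mathcal{A}}(\Gamma)=\sum|\lambda|$, the sum running over all eigenvalues $\lambda$ of $\mathcal{A}$ counted with multiplicity. *)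

theory Defs
  imports "Graph_Theory.Graph_Theory" "Jordan_Normal_Form.Spectral_Radius"
begin

text \<open>Threshold graphs. Bit \<open>b\<^sub>i\<close> of the string is the list entry \<open>b ! (i - 1)\<close>, with
  \<open>True\<close> for 1 (dominating) and \<open>False\<close> for 0 (isolated). The first bit has no effect on the graph.
  A simple graph is a symmetric loop-free \<open>pair_pre_digraph\<close>: every edge is a pair of opposite arcs.\<close>

definition add_isolated :: "'a \<Rightarrow> 'a pair_pre_digraph \<Rightarrow> 'a pair_pre_digraph" where
  "add_isolated v G = \<lparr> pverts = insert v (pverts G), parcs = parcs G \<rparr>"

definition add_dominating :: "'a \<Rightarrow> 'a pair_pre_digraph \<Rightarrow> 'a pair_pre_digraph" where
  "add_dominating v G =
    \<lparr> pverts = insert v (pverts G),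
      parcs = parcs G \<union> {v} \<times> pverts G \<union> pverts G \<times> {v} \<rparr>"

primrec threshold_graph_upto :: "bool list \<Rightarrow> nat \<Rightarrow> nat pair_pre_digraph" where
  "threshold_graph_upto b 0 = \<lparr> pverts = {}, parcs = {} \<rparr>"
| "threshold_graph_upto b (Suc i) =
    (if b ! i then add_dominating else add_isolated) (Suc i) (threshold_graph_upto b i)"

definition threshold_graph :: "bool list \<Rightarrow> nat pair_pre_digraph" where
  "threshold_graph b = threshold_graph_upto b (length b)"

text \<open>The string \<open>0\<^bsup>s 1\<^esup>1\<^bsup>t 1\<^esup> \<dots> 0\<^bsup>s k\<^esup>1\<^bsup>t k\<^esup>\<close>.\<close>

definition block_string :: "nat \<Rightarrow> (nat \<Rightarrow> nat) \<Rightarrow> (nat \<Rightarrow> nat) \<Rightarrow> bool list" where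
  "block_string k s t =
    concat (map (\<lambda>i. replicate (s i) False @ replicate (t i) True) [1..<Suc k])"

text \<open>Matrices of a simple graph with vertex set \<open>{1..n}\<close>. Matrix indices start at 0, so
  index \<open>i\<close> belongs to vertex \<open>Suc i\<close>. The entries are complex so that the spectrum contains
  all eigenvalues without any appeal to their being real.\<close>

definition adjacency_matrix :: "nat pair_pre_digraph \<Rightarrow> complex mat" where
  "adjacency_matrix G =
    mat (card (pverts G)) (card (pverts G))
      (\<lambda>(i, j). if (Suc i, Suc j) \<in> parcs G then 1 else 0)"

definition degree_matrix :: "nat pair_pre_digraph \<Rightarrow> complex mat" where
  "degree_matrix G =
    mat_diag (card (pverts G)) (\<lambda>i. of_nat (out_degree (with_proj G) (Suc i)))"

text \<open>Meaningful only if no vertex is isolated, since otherwise \<open>mat_inverse\<close> gives \<open>None\<close>.\<close>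

definition normalized_adjacency_matrix :: "nat pair_pre_digraph \<Rightarrow> complex mat" where
  "normalized_adjacency_matrix G = the (mat_inverse (degree_matrix G)) * adjacency_matrix G"

text \<open>Multiplicities are algebraic. For a graph they agree with the geometric ones, because
  \<open>D\<^sup>-\<^sup>1A\<close> is similar to a real symmetric matrix.\<close>

definition normalized_adjacency_energy :: "nat pair_pre_digraph \<Rightarrow> real" where
  "normalized_adjacency_energy G =
    (let M = normalized_adjacency_matrix G
     in \<Sum>\<mu>\<in>spectrum M. real (Polynomial.order \<mu> (char_poly M)) * cmod \<mu>)"

lemma pverts_threshold_graph_upto: "pverts (threshold_graph_upto b m) = {1..m}"
  by (induction m) (auto simp: add_isolated_def add_dominating_def)

lemma parcs_threshold_graph_upto:
  "(u, v) \<in> parcs (threshold_graph_upto b m) \<longleftrightarrow>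
     u \<noteq> v \<and> u \<in> {1..m} \<and> v \<in> {1..m} \<and> b ! (max u v - 1)"
proof (induction m)
  case 0
  then show ?case by simp
next
  case (Suc m)
  then show ?case
    by (auto simp: add_isolated_def add_dominating_def pverts_threshold_graph_upto max_def le_Suc_eq)
qed

lemma pverts_threshold_graph: "pverts (threshold_graph b) = {1..length b}"
  by (simp add: threshold_graph_def pverts_threshold_graph_upto)

lemma parcs_threshold_graph:
  "(u, v) \<in> parcs (threshold_graph b) \<longleftrightarrow>
     u \<noteq> v \<and> u \<in> {1..length b} \<and> v \<in> {1..length b} \<and> b ! (max u v - 1)"
  by (simp only: threshold_graph_def parcs_threshold_graph_upto)

lemma pair_graph_threshold_graph: "pair_graph (threshold_graph b)"
proof -
  have "parcs (threshold_graph b) \<subseteq> {1..length b} \<times> {1..length b}"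
    by (auto simp: parcs_threshold_graph)
  then have "finite (parcs (threshold_graph b))"
    by (rule finite_subset) simp
  then show ?thesis
    by unfold_locales
      (auto simp: pverts_threshold_graph parcs_threshold_graph symmetric_def sym_def max.commute)
qed

lemma mat_inverse_degree_matrix:
  assumes "\<And>i. i < card (pverts G) \<Longrightarrow> out_degree (with_proj G) (Suc i) \<noteq> 0"
  shows "mat_inverse (degree_matrix G) =
    Some (mat_diag (card (pverts G)) (\<lambda>i. inverse (of_nat (out_degree (with_proj G) (Suc i)))))"
    (is "_ = Some ?B")
proof -
  let ?n = "card (pverts G)"
  have D: "degree_matrix G \<in> carrier_mat ?n ?n" by (simp add: degree_matrix_def)
  have B: "?B \<in> carrier_mat ?n ?n" by simp
  have DB: "degree_matrix G * ?B = 1\<^sub>m ?n" and BD: "?B * degree_matrix G = 1\<^sub>m ?n"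
    unfolding degree_matrix_def mat_diag_diag using assms
    by (auto simp: mat_diag_def one_mat_def intro!: eq_matI)
  then have "degree_matrix G \<in> Units (ring_mat TYPE(complex) ?n undefined)"
    using D B by (auto simp: Units_def ring_mat_simps intro!: bexI[of _ ?B])
  then obtain C where C: "mat_inverse (degree_matrix G) = Some C"
    using mat_inverse(1)[OF D] by fastforce
  from mat_inverse(2)[OF D this] have "C * degree_matrix G = 1\<^sub>m ?n" "C \<in> carrier_mat ?n ?n"
    by auto
  then have "C = ?B"
    by (metis D B DB assoc_mult_mat left_mult_one_mat right_mult_one_mat)
  with C show ?thesis by simp
qed

end

theory Submission
  imports Defs
begin

text \<open>Let \<open>D\<close> be the degree matrix. The number 1 is an eigenvalue of \<open>D\<^sup>-\<^sup>1A\<close>, and the trace of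
  \<open>D\<^sup>-\<^sup>1A\<close> is 0, so the other eigenvalues sum to \<open>-1\<close> and the energy is at least 2. The lower bound
  follows because a vertex of the \<open>i\<close>-th block of ones has degree \<open>D\<^sub>i = T + S\<^sub>i - 1 \<ge> T\<close>, which gives
  \<open>k/T + \<Sum>\<^sub>i (t\<^sub>i - 1)/D\<^sub>i \<le> k/T + (T - k)/T = 1\<close>.

  The upper bound uses the following estimate (\<open>row_scaled_rank_one_sum\<close>). Whenever
  \<open>A = \<Sum>\<^sub>x \<sigma>\<^sub>x g\<^sub>x g\<^sub>x\<^sup>T\<close>, the absolute values of the eigenvalues of \<open>D\<^sup>-\<^sup>1A\<close> add up to at most
  \<open>\<Sum>\<^sub>x \<bar>\<sigma>\<^sub>x\<bar> g\<^sub>x\<^sup>TD\<^sup>-\<^sup>1g\<^sub>x\<close>. This is the triangle inequality for the trace norm, applied to the similar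
  matrix \<open>R\<^sup>-\<^sup>1AR\<^sup>-\<^sup>1\<close> with \<open>R = \<surd>D\<close>. No eigenvalue has to be computed; a good decomposition suffices.

  Let \<open>Z\<^sub>i\<close> be the \<open>i\<close>-th block of ones and \<open>P\<^sub>i\<close> the set of all vertices before it. Every edge belongs to
  the block of its later endpoint, so \<open>A\<close> is the sum over \<open>i\<close> of the matrices that join \<open>Z\<^sub>i\<close> to \<open>P\<^sub>i\<close>
  and to itself. With \<open>p\<close>, \<open>z\<close> the indicator vectors of \<open>P\<^sub>i\<close>, \<open>Z\<^sub>i\<close>, the \<open>i\<close>-th summand equals
  \<open>(\<alpha>p + \<gamma>z)(\<alpha>p + \<gamma>z)\<^sup>T - (\<alpha>p + \<beta>z)(\<alpha>p + \<beta>z)\<^sup>T - C\<close>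
  with \<open>\<gamma> = \<beta> + 1/\<alpha>\<close> and \<open>2\<beta>/\<alpha> + 1/\<alpha>\<^sup>2 = 1 - 1/t\<^sub>i\<close>, where \<open>C\<close> is the projection onto the vectors that live
  on \<open>Z\<^sub>i\<close> and have sum 0. The projection accounts for the term \<open>(t\<^sub>i - 1)/D\<^sub>i\<close>. Since the summand has
  zero diagonal, the positive and the negative part contribute equally, which explains the factor 2. It remains
  to choose \<open>\<alpha>\<close> such that the vector \<open>\<alpha>p + \<beta>z\<close> contributes at most \<open>c = (n - t\<^sub>k)/(n - 1)\<close>
  (\<open>rank_one_pieces_of_block\<close>). This is possible if \<open>\<Sum>\<^sub>v p\<^sub>v/d\<^sub>v\<close>, the total inverse degree before the
  block, is small enough, and \<open>ones_block_estimate\<close> shows that it is, because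
  each vertex of \<open>P\<^sub>i\<close> is adjacent to all vertices of \<open>Z\<^sub>i, \<dots>, Z\<^sub>k\<close> and has degree at least
  \<open>t\<^sub>i + \<dots> + t\<^sub>k\<close>.\<close>

section \<open>Eigenvalues of sums of rank-one matrices\<close>

text \<open>Gram--Schmidt, with normalised columns because the deflation below rests on a change of basis that
  preserves norms.\<close>

lemma unitary_completion:
  fixes v :: "complex vec"
  assumes v: "v \<in> carrier_vec n" "v \<noteq> 0\<^sub>v n"
  obtains W :: "complex mat" and r :: complex where
    "W \<in> carrier_mat n n" "mat_adjoint W * W = 1\<^sub>m n" "W * mat_adjoint W = 1\<^sub>m n"
    "col W 0 = r \<cdot>\<^sub>v v"
proof -
  have n: "n > 0" using v by (cases n) auto
  interpret cof_vec_space n "TYPE(complex)" .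
  define b where "b = basis_completion v"
  define ws where "ws = gram_schmidt n b"
  from basis_completion[OF v, folded b_def]
  have dist_b: "distinct b" and indep: "\<not> lin_dep (set b)" and b: "set b \<subseteq> carrier_vec n"
    and hdb: "hd b = v" and len_b: "length b = n" by auto
  from hdb len_b n obtain vs where bv: "b = v # vs" by (cases b) auto
  from gram_schmidt_result[OF b dist_b indep refl, folded ws_def]
  have ws: "set ws \<subseteq> carrier_vec n" "corthogonal ws" "length ws = n"
    by (auto simp: len_b)
  from gram_schmidt_hd[OF v(1), of vs, folded bv] have hdws: "hd ws = v" unfolding ws_def .
  have wsc: "ws ! j \<in> carrier_vec n" if "j < n" for j using ws that by auto
  define d where "d j = (\<Sum>p<n. (cmod (ws ! j $ p))\<^sup>2)" for j
  have sp: "ws ! j \<bullet>c ws ! i = (\<Sum>p<n. ws ! j $ p * cnj (ws ! i $ p))" if "i < n" "j < n" for i j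
    using wsc[OF that(1)] wsc[OF that(2)]
    by (simp add: scalar_prod_def atLeast0LessThan)
  have d: "complex_of_real (d j) = ws ! j \<bullet>c ws ! j" if "j < n" for j
    using sp[OF that that] by (simp add: d_def flip: complex_norm_square)
  have dpos: "d j > 0" if "j < n" for j
  proof -
    have "d j \<noteq> 0" using d[OF that] corthogonalD[OF ws(2), of j j] that ws(3) by auto
    moreover have "d j \<ge> 0" by (simp add: d_def sum_nonneg)
    ultimately show ?thesis by simp
  qed
  define W where "W = mat n n (\<lambda>(i, j). ws ! j $ i / of_real (sqrt (d j)))"
  have W: "W \<in> carrier_mat n n" by (simp add: W_def)
  have Wh: "mat_adjoint W \<in> carrier_mat n n" using W by (auto simp: mat_adjoint_def mat_of_rows_def)
  have Whe: "mat_adjoint W $$ (i, j) = cnj (W $$ (j, i))" if "i < n" "j < n" for i j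
    using that W by (simp add: mat_adjoint_def mat_of_rows_def)
  have "(mat_adjoint W * W) $$ (i, j) = 1\<^sub>m n $$ (i, j)" if ij: "i < n" "j < n" for i j
  proof -
    have "(mat_adjoint W * W) $$ (i, j) = (\<Sum>p<n. cnj (W $$ (p, i)) * W $$ (p, j))"
      using ij W Wh by (simp add: scalar_prod_def Whe atLeast0LessThan)
    also have "\<dots> = (\<Sum>p<n. ws ! j $ p * cnj (ws ! i $ p) / of_real (sqrt (d i) * sqrt (d j)))"
      using ij by (intro sum.cong) (auto simp: W_def)
    also have "\<dots> = (ws ! j \<bullet>c ws ! i) / of_real (sqrt (d i) * sqrt (d j))"
      by (simp add: sp[OF ij] sum_divide_distrib)
    also have "\<dots> = (if i = j then 1 else 0)"
    proof (cases "i = j")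
      case True
      then show ?thesis using d[OF ij(1), symmetric] dpos[OF ij(1)] by (simp flip: of_real_mult)
    next
      case False
      then show ?thesis using corthogonalD[OF ws(2), of j i] ij ws(3) by auto
    qed
    finally show ?thesis using ij by simp
  qed
  then have 1: "mat_adjoint W * W = 1\<^sub>m n" using W Wh by (intro eq_matI) auto
  then have 2: "W * mat_adjoint W = 1\<^sub>m n" using mat_mult_left_right_inverse[OF Wh W] by simp
  have "ws ! 0 = v" using hdws ws(3) n by (cases ws) auto
  then have "col W 0 = (1 / of_real (sqrt (d 0))) \<cdot>\<^sub>v v"
    using n v by (intro eq_vecI) (auto simp: W_def)
  with W 1 2 show ?thesis using that by blast
qed

text \<open>Deflation: in an orthonormal basis whose first vector is an eigenvector for \<open>e\<close>, the first column of the
  matrix is \<open>(e, 0, \<dots>, 0)\<close>, so the remaining eigenvalues are those of the lower right block. If the matrix is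
  \<open>\<Sum>\<^sub>a \<sigma>\<^sub>a f\<^sub>a f\<^sub>a\<^sup>*\<close>, this block has the same form, with the first coordinate of each transformed vector
  removed. The weight \<open>c a j\<close> is the squared modulus of the coordinate of \<open>f\<^sub>a\<close> that is split off in step \<open>j\<close>.
  For each \<open>a\<close> these weights add up to the squared norm of \<open>f\<^sub>a\<close>. The trace and the trace-norm estimate
  both follow.\<close>

lemma eigenvalues_of_rank_one_sum:
  fixes \<sigma> :: "'a \<Rightarrow> complex" and f :: "'a \<Rightarrow> nat \<Rightarrow> complex" and es :: "complex list"
  assumes "char_poly (mat n n (\<lambda>(v, w). \<Sum>a\<in>I. \<sigma> a * f a v * cnj (f a w))) = (\<Prod>e\<leftarrow>es. [:- e, 1:])"
  shows "\<exists>c :: 'a \<Rightarrow> nat \<Rightarrow> real.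
    (\<forall>a. \<forall>j<n. c a j \<ge> 0) \<and> (\<forall>a. (\<Sum>j<n. c a j) = (\<Sum>v<n. (cmod (f a v))\<^sup>2)) \<and>
    length es = n \<and> (\<forall>j<n. es ! j = (\<Sum>a\<in>I. \<sigma> a * c a j))"
  using assms
proof (induction es arbitrary: n f)
  case Nil
  let ?N = "mat n n (\<lambda>(v, w). \<Sum>a\<in>I. \<sigma> a * f a v * cnj (f a w))"
  have "degree (char_poly ?N) = n" using degree_monic_char_poly[of ?N n] by auto
  with Nil have "n = 0" by simp
  then show ?case by auto
next
  case (Cons e es)
  define N where "N = mat n n (\<lambda>(v, w). \<Sum>a\<in>I. \<sigma> a * f a v * cnj (f a w))"
  have N: "N \<in> carrier_mat n n" by (simp add: N_def)
  have cp: "char_poly N = [:- e, 1:] * (\<Prod>e\<leftarrow>es. [:- e, 1:])"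
    using Cons.prems by (simp add: N_def)
  have "eigenvalue N e" unfolding eigenvalue_root_char_poly[OF N] cp by simp
  then obtain u where "eigenvector N u e" by (auto simp: eigenvalue_def)
  then have u: "u \<in> carrier_vec n" "u \<noteq> 0\<^sub>v n" and Nu: "N *\<^sub>v u = e \<cdot>\<^sub>v u"
    using N by (auto simp: eigenvector_def)
  then obtain m where n: "n = Suc m" by (cases n) auto
  obtain W r where W: "W \<in> carrier_mat n n" and inv: "mat_adjoint W * W = 1\<^sub>m n" "W * mat_adjoint W = 1\<^sub>m n"
    and col: "col W 0 = r \<cdot>\<^sub>v u" by (rule unitary_completion[OF u])
  have Wh: "mat_adjoint W \<in> carrier_mat n n" using W by (auto simp: mat_adjoint_def mat_of_rows_def)
  have Whe: "mat_adjoint W $$ (i, j) = cnj (W $$ (j, i))" if "i < n" "j < n" for i j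
    using that W by (simp add: mat_adjoint_def mat_of_rows_def)
  define N' where "N' = mat_adjoint W * N * W"
  have N': "N' \<in> carrier_mat n n" using W Wh N by (simp add: N'_def)
  have "similar_mat_wit N' N (mat_adjoint W) W"
    by (rule similar_mat_witI[of _ _ n]) (use W Wh N N' inv in \<open>auto simp: N'_def\<close>)
  then have cpN': "char_poly N' = char_poly N"
    by (intro char_poly_similar) (auto simp: similar_mat_def)
  \<comment> \<open>The transformed vectors \<open>W\<^sup>*f\<^sub>a\<close>.\<close>
  define g where "g a i = (\<Sum>p<n. cnj (W $$ (p, i)) * f a p)" for a i
  have N'e: "N' $$ (i, j) = (\<Sum>a\<in>I. \<sigma> a * g a i * cnj (g a j))" if "i < n" "j < n" for i j
  proof -
    have "N' = mat_adjoint W * (N * W)" using W Wh N by (simp add: N'_def)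
    then have "N' $$ (i, j) = (\<Sum>p<n. cnj (W $$ (p, i)) * (\<Sum>q<n. N $$ (p, q) * W $$ (q, j)))"
      using that W Wh N by (simp add: scalar_prod_def Whe atLeast0LessThan)
    also have "\<dots> = (\<Sum>p<n. \<Sum>q<n. \<Sum>a\<in>I. \<sigma> a * (cnj (W $$ (p, i)) * f a p) * cnj (cnj (W $$ (q, j)) * f a q))"
      by (simp add: N_def sum_distrib_left sum_distrib_right mult_ac)
    also have "\<dots> = (\<Sum>a\<in>I. \<Sum>p<n. \<Sum>q<n. \<sigma> a * (cnj (W $$ (p, i)) * f a p) * cnj (cnj (W $$ (q, j)) * f a q))"
      by (subst sum.swap[of _ _ I]) (intro sum.cong refl sum.swap)
    also have "\<dots> = (\<Sum>a\<in>I. \<sigma> a * g a i * cnj (g a j))"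
      by (intro sum.cong refl)
         (simp only: mult.assoc[of "\<sigma> _"] sum_distrib_left[symmetric], simp only: g_def cnj_sum sum_distrib_right)
    finally show ?thesis .
  qed
  have norm: "(\<Sum>i<n. (cmod (g a i))\<^sup>2) = (\<Sum>v<n. (cmod (f a v))\<^sup>2)" for a
  proof -
    have WW: "(\<Sum>i<n. W $$ (q, i) * cnj (W $$ (p, i))) = (if p = q then 1 else 0)" if "p < n" "q < n" for p q
    proof -
      have "(W * mat_adjoint W) $$ (q, p) = (\<Sum>i<n. W $$ (q, i) * cnj (W $$ (p, i)))"
        using that W Wh by (simp add: scalar_prod_def Whe atLeast0LessThan)
      then show ?thesis using inv(2) that by auto
    qed
    have "of_real (\<Sum>i<n. (cmod (g a i))\<^sup>2) = (\<Sum>i<n. g a i * cnj (g a i))"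
      by (simp flip: complex_norm_square)
    also have "\<dots> = (\<Sum>i<n. \<Sum>p<n. \<Sum>q<n. f a p * cnj (f a q) * (W $$ (q, i) * cnj (W $$ (p, i))))"
      by (simp add: g_def sum_distrib_left sum_distrib_right mult_ac)
         (intro sum.cong refl sum.swap)
    also have "\<dots> = (\<Sum>p<n. \<Sum>q<n. f a p * cnj (f a q) * (\<Sum>i<n. W $$ (q, i) * cnj (W $$ (p, i))))"
      unfolding sum_distrib_left by (subst sum.swap) (intro sum.cong refl sum.swap)
    also have "\<dots> = (\<Sum>p<n. f a p * cnj (f a p))"
      by (simp add: WW if_distrib cong: if_cong)
    also have "\<dots> = of_real (\<Sum>v<n. (cmod (f a v))\<^sup>2)"
      by (simp flip: complex_norm_square)
    finally show ?thesis by (simp only: of_real_eq_iff)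
  qed
  have col0: "N' $$ (i, 0) = (if i = 0 then e else 0)" if i: "i < n" for i
  proof -
    have "N *\<^sub>v col W 0 = e \<cdot>\<^sub>v col W 0"
      using Nu u N by (simp add: col mult_mat_vec smult_smult_assoc mult.commute)
    moreover have "col (N * W) 0 = N *\<^sub>v col W 0" by (rule col_mult2[OF N W]) (simp add: n)
    moreover have "col N' 0 = mat_adjoint W *\<^sub>v col (N * W) 0"
      unfolding N'_def assoc_mult_mat[OF Wh N W]
      by (rule col_mult2[OF Wh]) (use N W n in auto)
    ultimately have "col N' 0 = mat_adjoint W *\<^sub>v (e \<cdot>\<^sub>v col W 0)" by simp
    also have "\<dots> = e \<cdot>\<^sub>v (mat_adjoint W *\<^sub>v col W 0)"
      by (rule mult_mat_vec[OF Wh]) (use u in \<open>simp add: col\<close>)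
    also have "mat_adjoint W *\<^sub>v col W 0 = col (mat_adjoint W * W) 0"
      by (rule col_mult2[OF Wh W, symmetric]) (simp add: n)
    finally have "col N' 0 = e \<cdot>\<^sub>v col (1\<^sub>m n) 0" by (simp add: inv)
    then have "col N' 0 $ i = (e \<cdot>\<^sub>v col (1\<^sub>m n) 0) $ i" by simp
    then show ?thesis using i n N' by (auto split: if_splits)
  qed
  define A3 where "A3 = mat m m (\<lambda>(v, w). \<Sum>a\<in>I. \<sigma> a * g a (Suc v) * cnj (g a (Suc w)))"
  define A1 where "A1 = mat 1 1 (\<lambda>_. e)"
  define A2 where "A2 = mat 1 m (\<lambda>(i, j). N' $$ (0, Suc j))"
  have blk: "N' = four_block_mat A1 A2 (0\<^sub>m m 1) A3"
    using N' col0 N'e n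
    by (intro eq_matI) (auto simp: A1_def A2_def A3_def)
  have "char_poly N' = char_poly A1 * char_poly A3"
    unfolding blk by (rule char_poly_four_block_zeros_col) (auto simp: A1_def A2_def A3_def)
  also have "char_poly A1 = [:- e, 1:]"
    by (simp add: A1_def char_poly_defs det_def sign_def)
  finally have "char_poly A3 = (\<Prod>e\<leftarrow>es. [:- e, 1:])"
    using cp cpN' by (metis mult_cancel_left pCons_eq_0_iff zero_neq_one)
  from Cons.IH[OF this[unfolded A3_def]] obtain c where
    c: "\<And>a j. j < m \<Longrightarrow> c a j \<ge> 0" "\<And>a. (\<Sum>j<m. c a j) = (\<Sum>v<m. (cmod (g a (Suc v)))\<^sup>2)"
      "length es = m" "\<And>j. j < m \<Longrightarrow> es ! j = (\<Sum>a\<in>I. \<sigma> a * c a j)" by blast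
  define c' where "c' a j = (case j of 0 \<Rightarrow> (cmod (g a 0))\<^sup>2 | Suc j \<Rightarrow> c a j)" for a j
  have "e = N' $$ (0, 0)" using col0[of 0] n by simp
  also have "\<dots> = (\<Sum>a\<in>I. \<sigma> a * c' a 0)"
    using N'e[of 0 0] n by (simp add: c'_def mult.assoc flip: complex_norm_square)
  finally have e: "e = (\<Sum>a\<in>I. \<sigma> a * c' a 0)" .
  show ?case
  proof (intro exI[of _ c'] conjI allI impI)
    fix a j assume "j < n"
    then show "c' a j \<ge> 0" using c(1) n by (auto simp: c'_def split: nat.splits)
  next
    fix a
    have "(\<Sum>j<n. c' a j) = (\<Sum>i<n. (cmod (g a i))\<^sup>2)"
      unfolding n sum.lessThan_Suc_shift by (simp add: c'_def c(2))
    then show "(\<Sum>j<n. c' a j) = (\<Sum>v<n. (cmod (f a v))\<^sup>2)" by (simp add: norm)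
  next
    show "length (e # es) = n" using c(3) n by simp
  next
    fix j assume "j < n"
    then show "(e # es) ! j = (\<Sum>a\<in>I. \<sigma> a * c' a j)"
      using e c(4) n by (cases j) (auto simp: c'_def)
  qed
qed

section \<open>Row-scaled symmetric matrices\<close>

lemma sum_spectrum_order:
  fixes M :: "complex mat" and es :: "complex list"
  assumes M: "M \<in> carrier_mat n n" and cp: "char_poly M = (\<Prod>e\<leftarrow>es. [:- e, 1:])"
  shows "(\<Sum>\<mu>\<in>spectrum M. real (Polynomial.order \<mu> (char_poly M)) * cmod \<mu>) = (\<Sum>e\<leftarrow>es. cmod e)"
proof -
  have nz: "char_poly M \<noteq> 0" using degree_monic_char_poly[OF M] by auto
  have "(\<Prod>e\<leftarrow>es. [:- e, 1:]) \<noteq> 0" for es :: "complex list"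
    by (induction es) (simp_all del: mult_pCons_left)
  then have "proots (\<Prod>e\<leftarrow>es. [:- e, 1:]) = mset es"
    by (induction es) (simp_all add: proots_mult del: mult_pCons_left)
  then have mset: "proots (char_poly M) = mset es" by (simp add: cp)
  have "spectrum M = set es"
    using spectrum_root_char_poly[OF M] set_count_proots[OF nz] mset by (metis set_mset_mset)
  moreover have "Polynomial.order \<mu> (char_poly M) = count (mset es) \<mu>" for \<mu>
    using count_proots[OF nz, of \<mu>] mset by simp
  moreover have "(\<Sum>\<mu>\<in>S. real (count (mset xs) \<mu>) * cmod \<mu>) = (\<Sum>e\<leftarrow>xs. cmod e)"
    if "set xs \<subseteq> S" "finite S" for xs :: "complex list" and S
    using that
  proof (induction xs)
    case (Cons a xs)
    have "(\<Sum>\<mu>\<in>S. real (count (mset (a # xs)) \<mu>) * cmod \<mu>) =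
      (\<Sum>\<mu>\<in>S. real (count (mset xs) \<mu>) * cmod \<mu> + (if a = \<mu> then cmod \<mu> else 0))"
      by (intro sum.cong) (auto simp: algebra_simps)
    with Cons show ?case by (simp add: sum.distrib)
  qed simp
  ultimately show ?thesis by simp
qed

text \<open>Dividing row \<open>v\<close> by \<open>d v\<close> gives a matrix that is similar to the one with entries
  \<open>A v w / sqrt (d v * d w)\<close>. In the latter the scaling is absorbed into the vectors \<open>g x\<close>, so
  that \<open>eigenvalues_of_rank_one_sum\<close> applies; the weights there are nonnegative, hence the triangle inequality
  gives the first conclusion and plain summation the second.\<close>

lemma row_scaled_rank_one_sum:
  fixes A :: "nat \<Rightarrow> nat \<Rightarrow> real" and d :: "nat \<Rightarrow> real" and \<sigma> :: "'a \<Rightarrow> real" and g :: "'a \<Rightarrow> nat \<Rightarrow> real"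
  assumes d: "\<And>v. v < n \<Longrightarrow> d v > 0"
    and A: "\<And>v w. v < n \<Longrightarrow> w < n \<Longrightarrow> A v w = (\<Sum>x\<in>I. \<sigma> x * g x v * g x w)"
    and cp: "char_poly (mat n n (\<lambda>(v, w). complex_of_real (A v w / d v))) = (\<Prod>e\<leftarrow>es. [:- e, 1:])"
  shows "(\<Sum>e\<leftarrow>es. cmod e) \<le> (\<Sum>x\<in>I. \<bar>\<sigma> x\<bar> * (\<Sum>v<n. (g x v)\<^sup>2 / d v))"
    and "sum_list es = complex_of_real (\<Sum>v<n. A v v / d v)"
proof -
  let ?M = "mat n n (\<lambda>(v, w). complex_of_real (A v w / d v))"
  define f where "f x v = complex_of_real (g x v / sqrt (d v))" for x v
  define N where "N = mat n n (\<lambda>(v, w). \<Sum>x\<in>I. complex_of_real (\<sigma> x) * f x v * cnj (f x w))"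
  define R where "R = mat_diag n (\<lambda>v. complex_of_real (sqrt (d v)))"
  define R' where "R' = mat_diag n (\<lambda>v. complex_of_real (inverse (sqrt (d v))))"
  have c: "?M \<in> carrier_mat n n" "N \<in> carrier_mat n n" "R \<in> carrier_mat n n" "R' \<in> carrier_mat n n"
    by (auto simp: N_def R_def R'_def)
  have Ne: "N $$ (v, w) = complex_of_real (A v w / (sqrt (d v) * sqrt (d w)))" if "v < n" "w < n" for v w
    using that by (simp add: N_def f_def A sum_divide_distrib)
  have "R' * R = 1\<^sub>m n" "R * R' = 1\<^sub>m n"
    unfolding R_def R'_def mat_diag_diag using d
    by (auto simp: mat_diag_def one_mat_def less_imp_neq[THEN not_sym] simp flip: of_real_mult intro!: eq_matI)
  moreover have "?M = R' * N * R"
  proof (rule eq_matI)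
    fix v w assume "v < dim_row (R' * N * R)" "w < dim_col (R' * N * R)"
    then have vw: "v < n" "w < n" using c by auto
    have "(R' * N * R) $$ (v, w) = complex_of_real (inverse (sqrt (d v)) * (A v w / (sqrt (d v) * sqrt (d w))) * sqrt (d w))"
      using vw c(2) Ne[OF vw] by (simp add: R_def R'_def mat_diag_mult_left[of N n n] mat_diag_mult_right[of _ n n])
    also have "inverse (sqrt (d v)) * (A v w / (sqrt (d v) * sqrt (d w))) * sqrt (d w) = A v w / (sqrt (d v) * sqrt (d v))"
      using d[OF vw(1)] d[OF vw(2)] by (simp add: field_simps)
    also have "\<dots> = A v w / d v" using d[OF vw(1)] by simp
    finally show "?M $$ (v, w) = (R' * N * R) $$ (v, w)" using vw by simp
  qed (use c in auto)
  ultimately have "similar_mat_wit ?M N R' R" using c by (intro similar_mat_witI[of _ _ n])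
  then have "char_poly N = (\<Prod>e\<leftarrow>es. [:- e, 1:])"
    using cp char_poly_similar[of ?M N] unfolding similar_mat_def by metis
  from eigenvalues_of_rank_one_sum[OF this[unfolded N_def]] obtain c where
    c: "\<And>x j. j < n \<Longrightarrow> c x j \<ge> 0" "\<And>x. (\<Sum>j<n. c x j) = (\<Sum>v<n. (cmod (f x v))\<^sup>2)"
      "length es = n" "\<And>j. j < n \<Longrightarrow> es ! j = (\<Sum>x\<in>I. complex_of_real (\<sigma> x) * c x j)" by blast
  have f: "(\<Sum>v<n. (cmod (f x v))\<^sup>2) = (\<Sum>v<n. (g x v)\<^sup>2 / d v)" for x
    using d by (intro sum.cong) (auto simp: f_def power_divide norm_divide less_imp_le)
  have "(\<Sum>e\<leftarrow>es. cmod e) = (\<Sum>j<n. cmod (es ! j))"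
    using c(3) by (simp add: sum_list_sum_nth atLeast0LessThan)
  also have "\<dots> \<le> (\<Sum>j<n. \<Sum>x\<in>I. \<bar>\<sigma> x\<bar> * c x j)"
    using c(1) by (intro sum_mono) (auto simp: c(4) norm_mult intro!: sum_norm_le)
  also have "\<dots> = (\<Sum>x\<in>I. \<bar>\<sigma> x\<bar> * (\<Sum>j<n. c x j))"
    unfolding sum_distrib_left by (rule sum.swap)
  finally show "(\<Sum>e\<leftarrow>es. cmod e) \<le> (\<Sum>x\<in>I. \<bar>\<sigma> x\<bar> * (\<Sum>v<n. (g x v)\<^sup>2 / d v))"
    by (simp add: c(2) f)
  have "sum_list es = (\<Sum>j<n. es ! j)"
    using c(3) by (simp add: sum_list_sum_nth atLeast0LessThan)
  also have "\<dots> = (\<Sum>j<n. \<Sum>x\<in>I. complex_of_real (\<sigma> x) * c x j)" by (simp add: c(4))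
  also have "\<dots> = complex_of_real (\<Sum>x\<in>I. \<sigma> x * (\<Sum>j<n. c x j))"
    by (subst sum.swap) (simp add: sum_distrib_left)
  also have "(\<Sum>x\<in>I. \<sigma> x * (\<Sum>j<n. c x j)) = (\<Sum>v<n. \<Sum>x\<in>I. \<sigma> x * g x v * g x v / d v)"
    by (subst sum.swap) (simp only: c(2) f sum_distrib_left, simp add: power2_eq_square mult.assoc)
  also have "\<dots> = (\<Sum>v<n. A v v / d v)" by (simp add: A sum_divide_distrib)
  finally show "sum_list es = complex_of_real (\<Sum>v<n. A v v / d v)" .
qed

text \<open>Apart from one occurrence of 1, the entries sum to \<open>-1\<close>, so their absolute values add up to at least 1.\<close>

lemma sum_cmod_ge_2:
  assumes "1 \<in> set es" "sum_list es = (0 :: complex)"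
  shows "(\<Sum>e\<leftarrow>es. cmod e) \<ge> 2"
proof -
  from assms(1) obtain xs ys where es: "es = xs @ 1 # ys" by (auto dest: split_list)
  have n: "cmod (sum_list zs) \<le> (\<Sum>e\<leftarrow>zs. cmod e)" for zs
    by (induction zs) (auto intro: norm_triangle_le)
  have "sum_list (xs @ ys) = - 1" using assms(2) es by (simp add: add_eq_0_iff algebra_simps)
  then have "cmod (sum_list (xs @ ys)) = 1" by simp
  with n[of "xs @ ys"] show ?thesis by (simp add: es)
qed

lemma eigenvalue_1_of_row_stochastic:
  fixes M :: "complex mat"
  assumes M: "M \<in> carrier_mat n n" and n: "n > 0" and rows: "\<And>v. v < n \<Longrightarrow> (\<Sum>w<n. M $$ (v, w)) = 1"
  shows "eigenvalue M 1"
proof -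
  let ?u = "vec n (\<lambda>_. 1 :: complex)"
  have "M *\<^sub>v ?u = 1 \<cdot>\<^sub>v ?u"
    using M rows by (intro eq_vecI) (auto simp: scalar_prod_def atLeast0LessThan)
  moreover have "?u \<noteq> 0\<^sub>v n" using n by (metis index_vec index_zero_vec(1) zero_neq_one)
  ultimately show ?thesis using M unfolding eigenvalue_def eigenvector_def by (intro exI[of _ ?u]) auto
qed

section \<open>The contribution of one block of ones\<close>

text \<open>The index \<open>Inl True\<close> is the positive square \<open>\<alpha>p + \<gamma>z\<close>, \<open>Inl False\<close> the negative square \<open>\<alpha>p + \<beta>z\<close>,
  and the \<open>Inr u\<close> are the columns of the projection \<open>diag z - zz\<^sup>T/t\<close>, which is idempotent and symmetric and
  therefore the sum of the squares of its columns. The two identities that \<open>\<alpha>\<close>, \<open>\<beta>\<close>, \<open>\<gamma>\<close> have to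
  satisfy leave \<open>\<alpha>\<close> free. The cost of the negative square is \<open>\<alpha>\<^sup>2P + \<beta>\<^sup>2q\<close> with \<open>P = \<Sum>\<^sub>v p v / d v\<close>, and
  its minimum over \<open>\<alpha>\<close> is the positive root \<open>x\<close> of \<open>x\<^sup>2 + xq(1 - 1/t) = Pq\<close>. The last assumption says that \<open>c\<close>
  is at least this root.\<close>

lemma rank_one_pieces_of_block:
  fixes p z d :: "nat \<Rightarrow> real" and c t q :: real
  assumes p: "\<And>v. v < n \<Longrightarrow> p v \<in> {0, 1}" and z: "\<And>v. v < n \<Longrightarrow> z v \<in> {0, 1}"
    and pz: "\<And>v. v < n \<Longrightarrow> p v * z v = 0" and d: "\<And>v. v < n \<Longrightarrow> d v > 0"
    and t: "t = (\<Sum>v<n. z v)" "t \<ge> 1" and q: "q = (\<Sum>v<n. z v / d v)" "q > 0" and c: "c > 0"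
    and cond: "(\<Sum>v<n. p v / d v) * q \<le> c\<^sup>2 + c * (q * (1 - 1 / t))"
  shows "\<exists>(\<sigma> :: bool + nat \<Rightarrow> real) g.
    (\<forall>v<n. \<forall>w<n. (\<Sum>x\<in>UNIV <+> {..<n}. \<sigma> x * g x v * g x w) =
      p v * z w + z v * p w + z v * z w - (if v = w then z v else 0)) \<and>
    (\<Sum>x\<in>UNIV <+> {..<n}. \<bar>\<sigma> x\<bar> * (\<Sum>v<n. (g x v)\<^sup>2 / d v)) \<le> 2 * (c + q * (1 - 1 / t))"
proof -
  define h where "h = 1 - 1 / t"
  \<comment> \<open>The optimal \<open>\<alpha>\<close> for the case of equality in the last assumption; for it, \<open>\<beta> = (\<alpha>\<^sup>2h - 1)/(2\<alpha>)\<close>\<close>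
  \<comment> \<open>simplifies to \<open>-c\<alpha>/q\<close>.\<close>
  define Y where "Y = 2 * c + q * h"
  define \<alpha> where "\<alpha> = sqrt (q / Y)"
  define \<beta> where "\<beta> = - c * \<alpha> / q"
  define \<gamma> where "\<gamma> = \<beta> + 1 / \<alpha>"
  have h: "h \<ge> 0" using t by (simp add: h_def)
  have Y: "Y > 0" using c q h by (simp add: Y_def add_pos_nonneg)
  have \<alpha>: "\<alpha> > 0" "\<alpha>\<^sup>2 = q / Y" using q Y by (auto simp: \<alpha>_def)
  have gb: "\<alpha> * \<gamma> - \<alpha> * \<beta> = 1" using \<alpha> by (simp add: \<gamma>_def field_simps)
  have "2 * \<beta> / \<alpha> + 1 / \<alpha>\<^sup>2 = h"
    using \<alpha>(1) q(2) Y unfolding \<alpha>(2) by (simp add: \<beta>_def Y_def field_simps)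
  moreover have "\<gamma>\<^sup>2 = \<beta>\<^sup>2 + (2 * \<beta> / \<alpha> + 1 / \<alpha>\<^sup>2)"
    by (simp add: \<gamma>_def power2_sum power_one_over)
  ultimately have gg: "\<gamma>\<^sup>2 = \<beta>\<^sup>2 + h" by simp
  define \<sigma> :: "bool + nat \<Rightarrow> real" where
    "\<sigma> x = (case x of Inl b \<Rightarrow> if b then 1 else - 1 | Inr u \<Rightarrow> - 1)" for x
  define g :: "bool + nat \<Rightarrow> nat \<Rightarrow> real" where
    "g x v = (case x of Inl b \<Rightarrow> \<alpha> * p v + (if b then \<gamma> else \<beta>) * z v
      | Inr u \<Rightarrow> z u * ((if u = v then 1 else 0) - z v / t))" for x v
  have proj: "(\<Sum>u<n. g (Inr u) v * g (Inr u) w) = (if v = w then z v else 0) - z v * z w / t"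
    if "v < n" "w < n" for v w
  proof -
    have "(\<Sum>u<n. g (Inr u) v * g (Inr u) w) =
      (\<Sum>u<n. (if u = v then if v = w then z u else 0 else 0) - (if u = v then z u * (z w / t) else 0)
        - (if u = w then z u * (z v / t) else 0) + z u * (z v * z w / t\<^sup>2))"
    proof (intro sum.cong refl)
      fix u assume "u \<in> {..<n}"
      then have "z u * z u = z u" using z[of u] by auto
      then show "g (Inr u) v * g (Inr u) w = (if u = v then if v = w then z u else 0 else 0)
        - (if u = v then z u * (z w / t) else 0)
        - (if u = w then z u * (z v / t) else 0) + z u * (z v * z w / t\<^sup>2)"
        by (auto simp: g_def algebra_simps power2_eq_square)
    qed
    also have "\<dots> = (if v = w then z v else 0) - z v * (z w / t) - z w * (z v / t) + t * (z v * z w / t\<^sup>2)"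
      using that by (simp add: sum.distrib sum_subtractf t(1) flip: sum_distrib_right sum_divide_distrib)
    also have "\<dots> = (if v = w then z v else 0) - z v * z w / t"
      using t(2) by (simp add: power2_eq_square)
    finally show ?thesis .
  qed
  have split: "(\<Sum>x\<in>UNIV <+> {..<n}. F x) = F (Inl True) + F (Inl False) + (\<Sum>u<n. F (Inr u))"
    for F :: "bool + nat \<Rightarrow> real"
    by (simp add: sum.Plus UNIV_bool)
  show ?thesis
  proof (intro exI[of _ \<sigma>] exI[of _ g] conjI allI impI)
    fix v w assume vw: "v < n" "w < n"
    have "(\<Sum>x\<in>UNIV <+> {..<n}. \<sigma> x * g x v * g x w) =
      (\<alpha> * p v + \<gamma> * z v) * (\<alpha> * p w + \<gamma> * z w) - (\<alpha> * p v + \<beta> * z v) * (\<alpha> * p w + \<beta> * z w)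
      - ((if v = w then z v else 0) - z v * z w / t)"
      unfolding split proj[OF vw, symmetric] by (simp add: \<sigma>_def g_def[of "Inl _"] sum_negf) (simp add: algebra_simps)
    also have "\<dots> = (\<alpha> * \<gamma> - \<alpha> * \<beta>) * (p v * z w + z v * p w) + (\<gamma>\<^sup>2 - \<beta>\<^sup>2) * (z v * z w)
      - ((if v = w then z v else 0) - z v * z w / t)"
      by (simp add: algebra_simps power2_eq_square)
    also have "\<dots> = p v * z w + z v * p w + z v * z w - (if v = w then z v else 0)"
      unfolding gb gg by (simp add: h_def algebra_simps)
    finally show "(\<Sum>x\<in>UNIV <+> {..<n}. \<sigma> x * g x v * g x w) =
      p v * z w + z v * p w + z v * z w - (if v = w then z v else 0)" .
  next
    let ?P = "\<Sum>v<n. p v / d v"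
    have two: "(\<Sum>v<n. (\<alpha> * p v + b * z v)\<^sup>2 / d v) = \<alpha>\<^sup>2 * ?P + b\<^sup>2 * q" for b
    proof -
      have "(\<alpha> * p v + b * z v)\<^sup>2 / d v = \<alpha>\<^sup>2 * (p v / d v) + b\<^sup>2 * (z v / d v)" if "v < n" for v
        using p[OF that] z[OF that] pz[OF that] by (auto simp: power_mult_distrib)
      then show ?thesis by (simp add: q(1) sum.distrib sum_distrib_left)
    qed
    have "(\<Sum>u<n. \<Sum>v<n. (g (Inr u) v)\<^sup>2 / d v) = (\<Sum>v<n. (\<Sum>u<n. g (Inr u) v * g (Inr u) v) / d v)"
      by (subst sum.swap) (simp add: power2_eq_square sum_divide_distrib)
    also have "\<dots> = (\<Sum>v<n. z v / d v * h)"
    proof (intro sum.cong refl)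
      fix v assume "v \<in> {..<n}"
      then have v: "v < n" by simp
      show "(\<Sum>u<n. g (Inr u) v * g (Inr u) v) / d v = z v / d v * h"
        using z[OF v] unfolding proj[OF v v] by (auto simp: h_def)
    qed
    also have "\<dots> = q * h" by (simp add: q(1) sum_distrib_right)
    finally have cen: "(\<Sum>u<n. \<Sum>v<n. (g (Inr u) v)\<^sup>2 / d v) = q * h" .
    have "\<beta>\<^sup>2 = c\<^sup>2 * \<alpha>\<^sup>2 / q\<^sup>2" by (simp add: \<beta>_def power_divide power_mult_distrib)
    then have "\<alpha>\<^sup>2 * ?P + \<beta>\<^sup>2 * q = (?P * q + c\<^sup>2) / Y"
      unfolding \<alpha>(2) using q(2) Y by (simp add: add_divide_distrib mult.commute power2_eq_square)
    also have "\<dots> \<le> (c\<^sup>2 + c * (q * h) + c\<^sup>2) / Y"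
      using cond Y by (simp add: h_def divide_right_mono)
    also have "\<dots> = c * Y / Y" by (simp add: Y_def algebra_simps power2_eq_square)
    also have "\<dots> = c" using Y by simp
    finally have "\<alpha>\<^sup>2 * ?P + \<beta>\<^sup>2 * q \<le> c" .
    then show "(\<Sum>x\<in>UNIV <+> {..<n}. \<bar>\<sigma> x\<bar> * (\<Sum>v<n. (g x v)\<^sup>2 / d v)) \<le> 2 * (c + q * (1 - 1 / t))"
      unfolding split using cen
      by (simp add: \<sigma>_def two g_def[of "Inl _"] gg h_def[symmetric] algebra_simps)
  qed
qed

text \<open>Here \<open>a\<close> and \<open>b\<close> are the sizes of the \<open>i\<close>-th and of the last block of ones, \<open>\<tau>\<close> is the number of ones from block
  \<open>i\<close> on, \<open>D\<close> is the degree in block \<open>i\<close>, and \<open>N = n - 1\<close> the degree in the last block. Then \<open>D + 1 - \<tau>\<close>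
  counts the vertices before block \<open>i\<close>, whose degrees are at least \<open>\<tau>\<close>. The two alternatives for \<open>\<tau>\<close> are the
  cases \<open>i = k\<close> and \<open>i < k\<close>. The number \<open>x\<close> is \<open>c\<close> with \<open>N\<close> replaced by \<open>D\<close>, and already \<open>x\<close> satisfies the
  inequality.\<close>

lemma ones_block_estimate:
  fixes a b \<tau> D N p c :: real
  assumes a: "a \<ge> 1" and b: "b \<ge> 1" and \<tau>: "a = b \<and> \<tau> = b \<or> a + b \<le> \<tau>" and D: "\<tau> \<le> D" "D \<le> N"
    and p: "p \<le> (D + 1 - \<tau>) / \<tau>" and c: "c = (N + 1 - b) / N"
  shows "p * (a / D) \<le> c\<^sup>2 + c * (a / D * (1 - 1 / a))"
proof -
  define x where "x = (D + 1 - b) / D"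
  have bD: "b \<le> D" "\<tau> > 0" "D > 0" "N > 0" using a b \<tau> D by auto
  have "(b - 1) / N \<le> (b - 1) / D" using bD b D by (intro divide_left_mono) auto
  moreover have "c = 1 - (b - 1) / N" "x = 1 - (b - 1) / D"
    using bD by (simp_all add: c x_def field_simps)
  ultimately have xc: "x \<le> c" by simp
  have x: "x \<ge> 0" using bD by (simp add: x_def)
  have "p * (a / D) \<le> (D + 1 - \<tau>) / \<tau> * (a / D)"
    using p a bD by (intro mult_right_mono) auto
  also have "\<dots> = a / \<tau> * ((D + 1 - \<tau>) / D)" by simp
  also have "\<dots> \<le> a / \<tau> * x"
    unfolding x_def using a bD \<tau> by (intro mult_left_mono divide_right_mono) auto
  also have "\<dots> \<le> (D - b + a) / D * x"
  proof (intro mult_right_mono x)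
    show "a / \<tau> \<le> (D - b + a) / D"
    proof (cases "a = b \<and> \<tau> = b")
      case True
      then show ?thesis using bD a by auto
    next
      case False
      have "b * b \<le> D * b + a * a"
        using mult_right_mono[of b D b] zero_le_square[of a] bD b by linarith
      then have "a * D \<le> (D - b + a) * (a + b)" by (simp add: algebra_simps)
      then have "a / (a + b) \<le> (D - b + a) / D"
        using a b bD by (simp add: divide_simps mult.commute)
      moreover have "a / \<tau> \<le> a / (a + b)" using False \<tau> a b by (intro divide_left_mono) auto
      ultimately show ?thesis by simp
    qed
  qed
  also have "(D - b + a) / D = x + (a - 1) / D" using bD by (simp add: x_def field_simps)
  also have "(x + (a - 1) / D) * x \<le> (c + (a - 1) / D) * c"
    using x xc a bD by (intro mult_mono) auto
  also have "\<dots> = c\<^sup>2 + c * (a / D * (1 - 1 / a))"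
    using a bD by (simp add: field_simps power2_eq_square)
  finally show ?thesis .
qed

section \<open>Threshold graphs of block strings\<close>

text \<open>Vertices are numbered from 0 here, like the matrix indices.\<close>

definition threshold_entry :: "bool list \<Rightarrow> nat \<Rightarrow> nat \<Rightarrow> real" where
  "threshold_entry b v w = (if v \<noteq> w \<and> b ! max v w then 1 else 0)"

lemma normalized_adjacency_matrix_threshold_graph:
  fixes b :: "bool list"
  defines "d \<equiv> \<lambda>v. \<Sum>w<length b. threshold_entry b v w"
  assumes d: "\<And>v. v < length b \<Longrightarrow> d v > 0"
  shows "normalized_adjacency_matrix (threshold_graph b) =
    mat (length b) (length b) (\<lambda>(v, w). complex_of_real (threshold_entry b v w / d v))"
proof -
  let ?G = "threshold_graph b" and ?n = "length b"
  have card: "card (pverts ?G) = ?n" by (simp add: pverts_threshold_graph)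
  have deg: "real (out_degree (with_proj ?G) (Suc v)) = d v" if v: "v < ?n" for v
  proof -
    have "out_arcs (with_proj ?G) (Suc v) = (\<lambda>w. (Suc v, Suc w)) ` {w. w < ?n \<and> v \<noteq> w \<and> b ! max v w}"
      (is "_ = ?R")
    proof (rule Set.set_eqI)
      fix e :: "nat \<times> nat"
      obtain x y where e: "e = (x, y)" by force
      show "e \<in> out_arcs (with_proj ?G) (Suc v) \<longleftrightarrow> e \<in> ?R"
        using v by (cases y) (auto simp: e out_arcs_def parcs_threshold_graph image_iff)
    qed
    then have "out_degree (with_proj ?G) (Suc v) = card {w. w < ?n \<and> v \<noteq> w \<and> b ! max v w}"
      by (simp add: out_degree_def card_image inj_on_def)
    moreover have "d v = (\<Sum>w\<in>{w. w < ?n \<and> v \<noteq> w \<and> b ! max v w}. 1)"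
      unfolding d_def by (rule sum.mono_neutral_cong_right) (auto simp: threshold_entry_def)
    ultimately show ?thesis by simp
  qed
  have deg': "complex_of_nat (out_degree (with_proj ?G) (Suc v)) = complex_of_real (d v)" if "v < ?n" for v
    using deg[OF that] by (metis of_real_of_nat_eq)
  have "out_degree (with_proj ?G) (Suc v) \<noteq> 0" if "v < ?n" for v
    using deg[OF that] d[OF that] by auto
  then have "mat_inverse (degree_matrix ?G) = Some (mat_diag ?n (\<lambda>i. inverse (of_nat (out_degree (with_proj ?G) (Suc i)))))"
    using mat_inverse_degree_matrix[of ?G] by (simp add: card)
  moreover have "adjacency_matrix ?G \<in> carrier_mat ?n ?n" by (simp add: adjacency_matrix_def card)
  ultimately show ?thesis
    unfolding normalized_adjacency_matrix_def
    by (intro eq_matI)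
       (auto simp: mat_diag_mult_left[of _ ?n ?n] deg' adjacency_matrix_def card parcs_threshold_graph
          threshold_entry_def divide_inverse)
qed

text \<open>The index of the first vertex of the \<open>i\<close>-th block of ones, counting vertices from 0.\<close>

definition ones_start :: "(nat \<Rightarrow> nat) \<Rightarrow> (nat \<Rightarrow> nat) \<Rightarrow> nat \<Rightarrow> nat" where
  "ones_start s t i = (\<Sum>j=1..i. s j) + (\<Sum>j=1..<i. t j)"

lemma ones_start_block_le:
  assumes "1 \<le> i" "i < j"
  shows "ones_start s t i + t i \<le> ones_start s t j"
proof -
  have "(\<Sum>j=1..i. s j) \<le> (\<Sum>j=1..j. s j)" using assms by (intro sum_mono2) auto
  moreover have "(\<Sum>j=1..<i. t j) + t i = (\<Sum>j=1..<Suc i. t j)" using assms by simp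
  moreover have "\<dots> \<le> (\<Sum>j=1..<j. t j)" using assms by (intro sum_mono2) auto
  ultimately show ?thesis by (simp add: ones_start_def)
qed

lemma block_string_Suc:
  "block_string (Suc k) s t = block_string k s t @ replicate (s (Suc k)) False @ replicate (t (Suc k)) True"
  by (simp add: block_string_def)

lemma length_block_string: "length (block_string k s t) = (\<Sum>i=1..k. s i) + (\<Sum>i=1..k. t i)"
  by (induction k) (simp_all add: block_string_Suc, simp add: block_string_def)

lemma ones_block_in_range:
  assumes "i \<in> {1..k}"
  shows "ones_start s t i + t i \<le> length (block_string k s t)"
proof (cases "i = k")
  case True
  then show ?thesis using assms by (cases k) (auto simp: ones_start_def length_block_string atLeastLessThanSuc_atLeastAtMost)
next
  case False
  then have "ones_start s t i + t i \<le> ones_start s t k" using assms by (intro ones_start_block_le) auto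
  also have "\<dots> \<le> length (block_string k s t)"
    unfolding ones_start_def length_block_string by (intro add_left_mono sum_mono2) auto
  finally show ?thesis .
qed

lemma nth_block_string:
  assumes "v < length (block_string k s t)"
  shows "block_string k s t ! v \<longleftrightarrow> (\<exists>i\<in>{1..k}. ones_start s t i \<le> v \<and> v < ones_start s t i + t i)"
  using assms
proof (induction k)
  case (Suc k)
  let ?L = "length (block_string k s t)"
  have new: "ones_start s t (Suc k) = ?L + s (Suc k)"
    by (simp add: ones_start_def length_block_string atLeastLessThanSuc_atLeastAtMost)
  have old: "ones_start s t i + t i \<le> ?L" if "i \<in> {1..k}" for i
    using that by (rule ones_block_in_range)
  have ex: "(\<exists>i\<in>{1..Suc k}. Q i) \<longleftrightarrow> (\<exists>i\<in>{1..k}. Q i) \<or> Q (Suc k)" for Q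
    by (auto simp: atLeastAtMostSuc_conv)
  show ?case
  proof (cases "v < ?L")
    case True
    then show ?thesis using Suc.IH unfolding ex new by (auto simp: block_string_Suc nth_append)
  next
    case False
    then have "\<not> (\<exists>i\<in>{1..k}. ones_start s t i \<le> v \<and> v < ones_start s t i + t i)"
      using old by fastforce
    then show ?thesis using False Suc.prems unfolding ex new
      by (auto simp: block_string_Suc nth_append)
  qed
qed (simp add: block_string_def)

definition before_block :: "(nat \<Rightarrow> nat) \<Rightarrow> (nat \<Rightarrow> nat) \<Rightarrow> nat \<Rightarrow> nat \<Rightarrow> real" where
  "before_block s t i v = (if v < ones_start s t i then 1 else 0)"

definition in_block :: "(nat \<Rightarrow> nat) \<Rightarrow> (nat \<Rightarrow> nat) \<Rightarrow> nat \<Rightarrow> nat \<Rightarrow> real" where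
  "in_block s t i v = (if ones_start s t i \<le> v \<and> v < ones_start s t i + t i then 1 else 0)"

text \<open>A pair of distinct vertices is an edge exactly if its later vertex lies in a block of ones. The \<open>i\<close>-th summand is
  the indicator of the edges whose later vertex lies in block \<open>i\<close>, and the blocks are disjoint.\<close>

lemma threshold_entry_block_string:
  assumes vw: "v < length (block_string k s t)" "w < length (block_string k s t)"
  shows "threshold_entry (block_string k s t) v w =
    (\<Sum>i=1..k. before_block s t i v * in_block s t i w + in_block s t i v * before_block s t i w
      + in_block s t i v * in_block s t i w - (if v = w then in_block s t i v else 0))"
    (is "?l = ?r")
proof -
  have uniq: "i = j" if "1 \<le> i" "1 \<le> j" "in_block s t i u = 1" "in_block s t j u = 1" for i j u
    using ones_start_block_le[of i j s t] ones_start_block_le[of j i s t] that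
    by (cases i j rule: linorder_cases) (auto simp: in_block_def split: if_splits)
  have "?r = (\<Sum>i=1..k. if v \<noteq> w \<and> in_block s t i (max v w) = 1 then 1 else 0)"
    by (intro sum.cong refl) (auto simp: in_block_def before_block_def max_def)
  also have "\<dots> = ?l"
  proof (cases "\<exists>i\<in>{1..k}. in_block s t i (max v w) = 1")
    case True
    then obtain i where i: "i \<in> {1..k}" "in_block s t i (max v w) = 1" by blast
    have "(\<Sum>j=1..k. if v \<noteq> w \<and> in_block s t j (max v w) = 1 then 1 else 0)
      = (\<Sum>j=1..k. if j = i then if v \<noteq> w then 1 else 0 else (0::real))"
      using uniq i by (intro sum.cong refl) fastforce
    also have "\<dots> = ?l"
      using i vw nth_block_string[of "max v w" k s t]
      by (auto simp: threshold_entry_def in_block_def split: if_splits)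
    finally show ?thesis .
  next
    case False
    then have "?l = 0"
      using vw nth_block_string[of "max v w" k s t] by (auto simp: threshold_entry_def in_block_def)
    moreover have "(\<Sum>i=1..k. if v \<noteq> w \<and> in_block s t i (max v w) = 1 then 1 else 0) = (0::real)"
      using False by (intro sum.neutral) auto
    ultimately show ?thesis by simp
  qed
  finally show ?thesis by simp
qed

lemma sum_before_block:
  assumes "i \<in> {1..k}"
  shows "(\<Sum>v<length (block_string k s t). before_block s t i v) = ones_start s t i"
proof -
  have "(\<Sum>v<length (block_string k s t). before_block s t i v) = (\<Sum>v<ones_start s t i. 1)"
    using ones_block_in_range[OF assms, of s t]
    by (intro sum.mono_neutral_cong_right) (auto simp: before_block_def)
  then show ?thesis by simp
qed

lemma sum_in_block:
  assumes "i \<in> {1..k}"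
  shows "(\<Sum>v<length (block_string k s t). in_block s t i v) = t i"
proof -
  have "(\<Sum>v<length (block_string k s t). in_block s t i v) = (\<Sum>v=ones_start s t i..<ones_start s t i + t i. 1)"
    using ones_block_in_range[OF assms, of s t]
    by (intro sum.mono_neutral_cong_right) (auto simp: in_block_def)
  then show ?thesis by simp
qed

lemma degree_block_string:
  assumes v: "v < length (block_string k s t)"
  shows "(\<Sum>w<length (block_string k s t). threshold_entry (block_string k s t) v w) =
    (\<Sum>i=1..k. before_block s t i v * t i + in_block s t i v * (real (ones_start s t i) + real (t i) - 1))"
proof -
  let ?n = "length (block_string k s t)"
  have "(\<Sum>w<?n. threshold_entry (block_string k s t) v w) =
    (\<Sum>i=1..k. \<Sum>w<?n. before_block s t i v * in_block s t i w + in_block s t i v * before_block s t i w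
      + in_block s t i v * in_block s t i w - (if v = w then in_block s t i v else 0))"
    using v by (subst sum.swap) (intro sum.cong refl threshold_entry_block_string, auto)
  also have "\<dots> = (\<Sum>i=1..k. before_block s t i v * t i + in_block s t i v * ones_start s t i
      + in_block s t i v * t i - in_block s t i v)"
    using v by (intro sum.cong refl)
      (simp add: sum.distrib sum_subtractf sum_in_block sum_before_block flip: sum_distrib_left)
  finally show ?thesis by (simp add: algebra_simps)
qed

lemma degree_in_ones_block:
  assumes v: "v < length (block_string k s t)" and i: "i \<in> {1..k}" "in_block s t i v = 1"
  shows "(\<Sum>w<length (block_string k s t). threshold_entry (block_string k s t) v w) =
    real (\<Sum>j=1..k. t j) + real (\<Sum>j=1..i. s j) - 1"
proof -
  have v: "ones_start s t i \<le> v" "v < ones_start s t i + t i"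
    using i by (auto simp: in_block_def split: if_splits)
  have "before_block s t j v * t j + in_block s t j v * (real (ones_start s t j) + real (t j) - 1) =
     (if j = i then real (ones_start s t i) + real (t i) - 1 else 0) + (if i < j then real (t j) else 0)"
    if "j \<in> {1..k}" for j
    using v that i ones_start_block_le[of i j s t] ones_start_block_le[of j i s t]
    by (cases i j rule: linorder_cases) (auto simp: in_block_def before_block_def)
  then have "(\<Sum>w<length (block_string k s t). threshold_entry (block_string k s t) v w) =
     real (ones_start s t i) + real (t i) - 1 + (\<Sum>j=1..k. if i < j then real (t j) else 0)"
    using assms i by (simp add: degree_block_string sum.distrib)
  also have "(\<Sum>j=1..k. if i < j then real (t j) else 0) = (\<Sum>j=Suc i..k. real (t j))"
    by (intro sum.mono_neutral_cong_right) auto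
  also have "real (ones_start s t i) = (\<Sum>j=1..i. s j) + (\<Sum>j=1..<i. real (t j))"
    by (simp add: ones_start_def)
  finally show ?thesis
  proof -
    assume *: "(\<Sum>w<length (block_string k s t). threshold_entry (block_string k s t) v w) =
       real (\<Sum>j=1..i. s j) + (\<Sum>j=1..<i. real (t j)) + real (t i) - 1 + (\<Sum>j=Suc i..k. real (t j))"
    have "{1..k} = {1..<i} \<union> {i..k}" "{1..<i} \<inter> {i..k} = {}" using i by auto
    then have "(\<Sum>j=1..k. real (t j)) = (\<Sum>j=1..<i. real (t j)) + (\<Sum>j=i..k. real (t j))"
      using sum.union_disjoint[of "{1..<i}" "{i..k}" "\<lambda>j. real (t j)"] by simp
    also have "(\<Sum>j=i..k. real (t j)) = real (t i) + (\<Sum>j=Suc i..k. real (t j))"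
      using i by (intro sum.atLeast_Suc_atMost) auto
    finally have "(\<Sum>j=1..k. real (t j)) = (\<Sum>j=1..<i. real (t j)) + (real (t i) + (\<Sum>j=Suc i..k. real (t j)))" .
    with * show ?thesis by simp
  qed
qed

text \<open>A vertex before block \<open>i\<close> is also before all later blocks, so all vertices of the blocks of ones \<open>i, \<dots>, k\<close> are
  neighbours.\<close>

lemma degree_before_block:
  assumes v: "v < length (block_string k s t)" and i: "i \<in> {1..k}" "before_block s t i v = 1"
  shows "(\<Sum>w<length (block_string k s t). threshold_entry (block_string k s t) v w) \<ge> (\<Sum>j=i..k. t j)"
proof -
  have v': "v < ones_start s t i" using i by (auto simp: before_block_def split: if_splits)
  have nn: "in_block s t j v * (real (ones_start s t j) + real (t j) - 1) \<ge> 0" for j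
    by (auto simp: in_block_def)
  have "real (\<Sum>j=i..k. t j) = (\<Sum>j=i..k. before_block s t j v * t j)"
  proof -
    have "v < ones_start s t j" if "j \<in> {i..k}" for j
      using that i v' ones_start_block_le[of i j s t] by (cases "i = j") auto
    then show ?thesis by (simp add: before_block_def)
  qed
  also have "\<dots> \<le> (\<Sum>j=1..k. before_block s t j v * t j)"
    using i by (intro sum_mono2) (auto simp: before_block_def)
  also have "\<dots> \<le> (\<Sum>w<length (block_string k s t). threshold_entry (block_string k s t) v w)"
    unfolding degree_block_string[OF v] using nn by (intro sum_mono) simp
  finally show ?thesis .
qed

section \<open>The energy of a threshold graph\<close>

theorem theorem3p2:
  fixes k n T :: nat and s t S :: "nat \<Rightarrow> nat" and \<Gamma> :: "nat pair_pre_digraph"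
  assumes "k \<ge> 1"
    and "\<And>i. i \<in> {1..k} \<Longrightarrow> s i > 0"
    and "\<And>i. i \<in> {1..k} \<Longrightarrow> t i > 0"
    and "\<Gamma> = threshold_graph (block_string k s t)"
    and "Digraph_Component.connected (with_proj \<Gamma>)"
    and "n = card (pverts \<Gamma>)"
    and "T = (\<Sum>i=1..k. t i)"
    and "\<And>i. S i = (\<Sum>j=1..i. s j)"
  shows "2 * (real k * (real n - real (t k)) / (real n - 1)
              + (\<Sum>i=1..k. (real (t i) - 1) / (real T + real (S i) - 1)))
           \<ge> normalized_adjacency_energy \<Gamma>
       \<and> normalized_adjacency_energy \<Gamma>
           \<ge> 2 * (real k / real T
              + (\<Sum>i=1..k. (real (t i) - 1) / (real T + real (S i) - 1)))"
proof -
  note k = assms(1) and s = assms(2) and t = assms(3)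
  define b where "b = block_string k s t"
  define a where "a = threshold_entry b"
  define d where "d v = (\<Sum>w<n. a v w)" for v
  define D where "D i = real T + real (S i) - 1" for i
  have nb: "n = length b" by (simp add: assms(4,6) b_def pverts_threshold_graph)
  have n: "n = S k + T" by (simp add: nb b_def length_block_string assms(7,8))
  have kk: "k \<in> {1..k}" using k by simp
  have S: "S i \<ge> 1" if "i \<in> {1..k}" for i
    using s[of i] that member_le_sum[of i "{1..i}" s] by (simp add: assms(8))
  have kT: "k \<le> T" using sum_mono[of "{1..k}" "\<lambda>_. 1" t] t by (simp add: assms(7) Suc_le_eq)
  have D: "D i \<ge> T" "D i > 0" if "i \<in> {1..k}" for i using S[OF that] kT k by (auto simp: D_def)
  have d_in: "d v = D i" if "v < n" "i \<in> {1..k}" "in_block s t i v = 1" for i v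
    using degree_in_ones_block[of v k s t i] that by (simp add: d_def a_def D_def nb b_def assms(7,8))
  have d_before: "d v \<ge> (\<Sum>j=i..k. t j)" if "v < n" "i \<in> {1..k}" "before_block s t i v = 1" for i v
    using degree_before_block[of v k s t i] that by (simp add: d_def a_def nb b_def)
  \<comment> \<open>Every vertex lies before or in the last block of ones, so no vertex is isolated.\<close>
  have dpos: "d v > 0" if v: "v < n" for v
  proof (cases "v < ones_start s t k")
    case True
    then have "d v \<ge> t k" using d_before[OF v kk] by (simp add: before_block_def)
    then show ?thesis using t[OF kk] by linarith
  next
    case False
    have "n = ones_start s t k + t k"
      using k unfolding n assms(7,8) ones_start_def by (cases k) (auto simp: atLeastLessThanSuc_atLeastAtMost)
    then show ?thesis using False v d_in[OF v kk] D[OF kk] by (simp add: in_block_def)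
  qed
  define M where "M = mat n n (\<lambda>(v, w). complex_of_real (a v w / d v))"
  have M: "M \<in> carrier_mat n n" by (simp add: M_def)
  obtain es where es: "char_poly M = (\<Prod>e\<leftarrow>es. [:- e, 1:])" using char_poly_factorized[OF M] by blast
  have "normalized_adjacency_matrix \<Gamma> = M"
    using normalized_adjacency_matrix_threshold_graph[of b] dpos
    by (simp add: M_def a_def d_def nb assms(4) b_def)
  then have E: "normalized_adjacency_energy \<Gamma> = (\<Sum>e\<leftarrow>es. cmod e)"
    using sum_spectrum_order[OF M es] by (simp add: normalized_adjacency_energy_def)

  define c where "c = (real n - real (t k)) / (real n - 1)"
  have tT: "t k \<le> T" using kk by (simp add: assms(7) member_le_sum)
  have t1: "t k \<ge> 1" using t[OF kk] by simp
  have c: "c > 0" using S[OF kk] tT t1 by (simp add: c_def n)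
  \<comment> \<open>\<open>\<sigma>\<close> and \<open>g\<close> decompose the part of \<open>A\<close> that belongs to block \<open>i\<close>, at a cost within the bound.\<close>
  define good where "good i \<sigma> g \<longleftrightarrow>
      (\<forall>v<n. \<forall>w<n. (\<Sum>x\<in>UNIV <+> {..<n}. \<sigma> x * g x v * g x w) =
        before_block s t i v * in_block s t i w + in_block s t i v * before_block s t i w
        + in_block s t i v * in_block s t i w - (if v = w then in_block s t i v else 0)) \<and>
      (\<Sum>x\<in>UNIV <+> {..<n}. \<bar>\<sigma> x\<bar> * (\<Sum>v<n. (g x v)\<^sup>2 / d v)) \<le> 2 * (c + (real (t i) - 1) / D i)"
    for i and \<sigma> :: "bool + nat \<Rightarrow> real" and g
  have "\<exists>\<sigma> g. good i \<sigma> g" if i: "i \<in> {1..k}" for i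
  proof -
    define q where "q = (\<Sum>v<n. in_block s t i v / d v)"
    define \<tau> where "\<tau> = real (\<Sum>j=i..k. t j)"
    have ti: "t i \<ge> 1" using t[OF i] by simp
    have "q = (\<Sum>v<n. in_block s t i v / D i)"
      unfolding q_def using d_in[OF _ i] by (intro sum.cong refl) (auto simp: in_block_def)
    also have "\<dots> = t i / D i"
      using sum_in_block[OF i, of s t] by (simp add: nb b_def flip: sum_divide_distrib)
    finally have q: "q = t i / D i" .
    have split: "(\<Sum>j=1..k. real (t j)) = (\<Sum>j=1..<i. real (t j)) + (\<Sum>j=i..k. real (t j))"
    proof -
      have "{1..k} = {1..<i} \<union> {i..k}" "{1..<i} \<inter> {i..k} = {}" using i by auto
      then show ?thesis using sum.union_disjoint[of "{1..<i}" "{i..k}" "\<lambda>j. real (t j)"] by simp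
    qed
    have \<tau>pos: "\<tau> \<ge> t i" unfolding \<tau>_def using i by (intro of_nat_mono member_le_sum) auto
    have "(\<Sum>v<n. before_block s t i v / d v) \<le> (\<Sum>v<n. before_block s t i v / \<tau>)"
      using d_before[OF _ i] dpos \<tau>pos ti
      by (intro sum_mono) (auto simp: before_block_def \<tau>_def intro!: divide_left_mono)
    also have "\<dots> = ones_start s t i / \<tau>"
      using sum_before_block[OF i, of s t] by (simp add: nb b_def flip: sum_divide_distrib)
    also have "real (ones_start s t i) = D i + 1 - \<tau>"
      using split by (simp add: ones_start_def D_def \<tau>_def assms(7,8))
    finally have p: "(\<Sum>v<n. before_block s t i v / d v) \<le> (D i + 1 - \<tau>) / \<tau>" .
    have "(\<Sum>v<n. before_block s t i v / d v) * (t i / D i)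
      \<le> c\<^sup>2 + c * (t i / D i * (1 - 1 / t i))"
    proof (rule ones_block_estimate[OF _ _ _ _ _ p, where b = "t k" and N = "real n - 1"])
      show "real (t i) = t k \<and> \<tau> = t k \<or> real (t i) + t k \<le> \<tau>"
      proof (cases "i = k")
        case False
        then have "sum t {i, k} \<le> sum t {i..k}" using i by (intro sum_mono2) auto
        then have "real (t i + t k) \<le> real (sum t {i..k})" using False by (intro of_nat_mono) simp
        then show ?thesis by (simp add: \<tau>_def)
      qed (simp add: \<tau>_def)
      have "\<tau> \<le> T" using split by (simp add: \<tau>_def assms(7) sum_nonneg)
      then show "\<tau> \<le> D i" using D(1)[OF i] by linarith
      have "S i \<le> S k" unfolding assms(8) using i by (intro sum_mono2) auto
      then show "D i \<le> real n - 1" by (simp add: D_def n)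
    qed (use ti t1 in \<open>auto simp: c_def\<close>)
    then have cond: "(\<Sum>v<n. before_block s t i v / d v) * q \<le> c\<^sup>2 + c * (q * (1 - 1 / t i))"
      by (simp add: q)
    have qpos: "q > 0" using q ti D(2)[OF i] by simp
    have ind: "before_block s t i v \<in> {0, 1}" "in_block s t i v \<in> {0, 1}"
      "before_block s t i v * in_block s t i v = 0" for v
      by (auto simp: before_block_def in_block_def)
    have tsum: "real (t i) = (\<Sum>v<n. in_block s t i v)"
      using sum_in_block[OF i, of s t] by (simp add: nb b_def)
    have ti': "real (t i) \<ge> 1" using ti by simp
    have qt: "q * (1 - 1 / t i) = (real (t i) - 1) / D i"
      using ti D(2)[OF i] by (simp add: q field_simps)
    show ?thesis
      unfolding good_def qt[symmetric]
      by (rule rank_one_pieces_of_block[of n "before_block s t i" "in_block s t i" d "t i" q c],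
          (rule ind dpos tsum ti' q_def qpos c cond | assumption)+)
  qed
  then obtain \<sigma> g where good: "\<And>i. i \<in> {1..k} \<Longrightarrow> good i (\<sigma> i) (g i)" by metis
  have g: "(\<Sum>x\<in>UNIV <+> {..<n}. \<sigma> i x * g i x v * g i x w) =
        before_block s t i v * in_block s t i w + in_block s t i v * before_block s t i w
        + in_block s t i v * in_block s t i w - (if v = w then in_block s t i v else 0)"
    if "i \<in> {1..k}" "v < n" "w < n" for i v w
    using good[OF that(1)] that(2,3) unfolding good_def by blast
  have norm: "(\<Sum>x\<in>UNIV <+> {..<n}. \<bar>\<sigma> i x\<bar> * (\<Sum>v<n. (g i x v)\<^sup>2 / d v)) \<le> 2 * (c + (real (t i) - 1) / D i)"
    if "i \<in> {1..k}" for i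
    using good[OF that] unfolding good_def by blast
  let ?I = "{1..k} \<times> ((UNIV :: bool set) <+> {..<n})"
  have a_sum: "a v w = (\<Sum>y\<in>?I. \<sigma> (fst y) (snd y) * g (fst y) (snd y) v * g (fst y) (snd y) w)"
    if "v < n" "w < n" for v w
  proof -
    have "a v w = (\<Sum>i=1..k. \<Sum>x\<in>UNIV <+> {..<n}. \<sigma> i x * g i x v * g i x w)"
      using that unfolding a_def b_def nb
      by (subst threshold_entry_block_string) (auto intro!: sum.cong simp: g[unfolded nb b_def])
    then show ?thesis by (simp add: sum.cartesian_product case_prod_beta)
  qed
  note energy = row_scaled_rank_one_sum[where d = d and A = a and I = ?I
      and \<sigma> = "\<lambda>y. \<sigma> (fst y) (snd y)" and g = "\<lambda>y. g (fst y) (snd y)", OF dpos a_sum es[unfolded M_def]]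
  have "(\<Sum>e\<leftarrow>es. cmod e) \<le> (\<Sum>i=1..k. \<Sum>x\<in>UNIV <+> {..<n}. \<bar>\<sigma> i x\<bar> * (\<Sum>v<n. (g i x v)\<^sup>2 / d v))"
    using energy(1) by (simp add: sum.cartesian_product case_prod_beta)
  also have "\<dots> \<le> (\<Sum>i=1..k. 2 * (c + (real (t i) - 1) / D i))"
    by (intro sum_mono norm)
  also have "\<dots> = 2 * (k * c + (\<Sum>i=1..k. (real (t i) - 1) / D i))"
    by (simp only: sum_distrib_left[symmetric] sum.distrib) simp
  finally have upper: "normalized_adjacency_energy \<Gamma> \<le> 2 * (k * c + (\<Sum>i=1..k. (real (t i) - 1) / D i))"
    by (simp add: E)

  \<comment> \<open>The lower bound: the all-ones vector is an eigenvector for 1, and the diagonal of \<open>A\<close> is 0.\<close>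
  have "eigenvalue M 1"
  proof (rule eigenvalue_1_of_row_stochastic[OF M])
    show "n > 0" using kT k by (simp add: n)
    show "(\<Sum>w<n. M $$ (v, w)) = 1" if v: "v < n" for v
    proof -
      have "(\<Sum>w<n. M $$ (v, w)) = complex_of_real (\<Sum>w<n. a v w / d v)" using v by (simp add: M_def)
      also have "(\<Sum>w<n. a v w / d v) = 1" using dpos[OF v] by (simp add: d_def flip: sum_divide_distrib)
      finally show ?thesis by simp
    qed
  qed
  then have "poly (char_poly M) 1 = 0" using eigenvalue_root_char_poly[OF M] by simp
  then have "1 \<in> set es" unfolding es by (auto simp: poly_prod_list prod_list_zero_iff)
  moreover have "sum_list es = 0" using energy(2) by (simp add: a_def threshold_entry_def)
  ultimately have E2: "normalized_adjacency_energy \<Gamma> \<ge> 2" using sum_cmod_ge_2 E by simp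
  have "(\<Sum>i=1..k. (real (t i) - 1) / D i) \<le> (\<Sum>i=1..k. (real (t i) - 1) / T)"
    using D t kT k by (intro sum_mono divide_left_mono) (auto simp: Suc_le_eq)
  also have "\<dots> = (real T - k) / T" by (simp add: assms(7) sum_subtractf flip: sum_divide_distrib)
  also have "\<dots> = 1 - k / T" using kT k by (simp add: diff_divide_distrib)
  finally have "k / T + (\<Sum>i=1..k. (real (t i) - 1) / D i) \<le> 1" by (simp add: le_diff_eq add.commute)
  then have "2 * (k / T + (\<Sum>i=1..k. (real (t i) - 1) / D i)) \<le> 2 * 1" by (rule mult_left_mono) simp
  with E2 have lower: "2 * (k / T + (\<Sum>i=1..k. (real (t i) - 1) / D i)) \<le> normalized_adjacency_energy \<Gamma>"
    by simp
  show ?thesis using upper lower by (simp add: c_def D_def)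
qed

end
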